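(* Every residually finite monoid is surjunctive.
   Context: A monoid $M$ is residually finite if for any two distinct elements $m,m'\in M$ there exist a finite monoid $N$ and a monoid morphism $\varphi\colon M\to N$ such that $\varphi(m)\neq\varphi(m')$. Let $M$ be a monoid and $A$ a set. The set $A^M$ of all maps $x\colon M\to A$ carries the shift action of $M$ given by $(mx)(m') := x(m'm)$ for $m,m'\in M$, and the prodiscrete uniform structure, for which a base of entourages is given by the sets $W_F := \{(x,y)\in A^M\times A^M : x|_F = y|_F\}$, $F$ running over all finite subsets of $M$. A cellular automaton over $M$ with alphabet $A$ is a map $\tau\colon A^M\to A^M$ that is $M$-equivariant ($\tau(mx)=m\tau(x)$ for all $m\in M$, $x\in A^M$) and uniformly continuous. The monoid $M$ is called surjunctive if, for every finite set $A$, every injective cellular automaton $\tau\colon A^M\to A^M$ is surjective. *)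

theory Defs
  imports "HOL-Algebra.Group" "HOL-Library.FuncSet" Complex_Main
begin

(* HOL-Algebra's "hom" only requires multiplicativity; for monoids, preservation of the
   identity has to be demanded separately. *)
definition monoid_hom :: "('a, 'c) monoid_scheme \<Rightarrow> ('b, 'd) monoid_scheme \<Rightarrow> ('a \<Rightarrow> 'b) set" where
  "monoid_hom M N = {\<phi> \<in> hom M N. \<phi> \<one>\<^bsub>M\<^esub> = \<one>\<^bsub>N\<^esub>}"

(* HOL cannot quantify existentially over types, so the finite monoids N have carrier a finite
   set of natural numbers. Up to isomorphism these are all finite monoids: see
   residually_finiteI below, which accepts finite monoids over an arbitrary type. *)
definition residually_finite :: "('a, 'c) monoid_scheme \<Rightarrow> bool" where
  "residually_finite M \<longleftrightarrow>
     (\<forall>m \<in> carrier M. \<forall>m' \<in> carrier M. m \<noteq> m' \<longrightarrow>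
        (\<exists>(N :: nat monoid) \<phi>. monoid N \<and> finite (carrier N) \<and>
            \<phi> \<in> monoid_hom M N \<and> \<phi> m \<noteq> \<phi> m'))"

lemma finite_monoid_nat_copy:
  fixes N :: "('b, 'd) monoid_scheme"
  assumes N: "monoid N" "finite (carrier N)"
    and hom: "\<phi> \<in> monoid_hom M N" and M: "monoid M" "m \<in> carrier M" "m' \<in> carrier M"
    and ne: "\<phi> m \<noteq> \<phi> m'"
  shows "\<exists>(N' :: nat monoid) \<psi>. monoid N' \<and> finite (carrier N') \<and>
           \<psi> \<in> monoid_hom M N' \<and> \<psi> m \<noteq> \<psi> m'"
proof -
  interpret N: monoid N by (rule N(1))
  interpret M: monoid M by (rule M(1))
  obtain f :: "'b \<Rightarrow> nat" where f: "inj_on f (carrier N)"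
    using finite_imp_inj_to_nat_seg[OF N(2)] by blast
  define g where "g = inv_into (carrier N) f"
  have g: "g (f x) = x" if "x \<in> carrier N" for x
    using f that by (simp add: g_def)
  define N' :: "nat monoid" where
    "N' = \<lparr>carrier = f ` carrier N, monoid.mult = (\<lambda>a b. f (g a \<otimes>\<^bsub>N\<^esub> g b)), one = f \<one>\<^bsub>N\<^esub>\<rparr>"
  have "monoid N'"
    by (rule monoidI) (auto simp: N'_def g N.m_assoc)
  moreover have "finite (carrier N')"
    using N(2) by (simp add: N'_def)
  moreover have "f \<circ> \<phi> \<in> monoid_hom M N'"
    using hom by (auto simp: monoid_hom_def hom_def N'_def g Pi_iff)
  moreover have "(f \<circ> \<phi>) m \<noteq> (f \<circ> \<phi>) m'"
    using hom M(2,3) ne f by (auto simp: monoid_hom_def hom_def Pi_iff inj_on_def)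
  ultimately show ?thesis by blast
qed

lemma residually_finiteI:
  fixes M :: "('a, 'c) monoid_scheme"
  assumes "monoid M"
    and "\<And>m m'. m \<in> carrier M \<Longrightarrow> m' \<in> carrier M \<Longrightarrow> m \<noteq> m' \<Longrightarrow>
           \<exists>(N :: 'b monoid) \<phi>. monoid N \<and> finite (carrier N) \<and>
             \<phi> \<in> monoid_hom M N \<and> \<phi> m \<noteq> \<phi> m'"
  shows "residually_finite M"
  unfolding residually_finite_def
proof (intro ballI impI)
  fix m m' assume m: "m \<in> carrier M" "m' \<in> carrier M" "m \<noteq> m'"
  from assms(2)[OF m] obtain N :: "'b monoid" and \<phi> where "monoid N" "finite (carrier N)"
    "\<phi> \<in> monoid_hom M N" "\<phi> m \<noteq> \<phi> m'" by blast
  from finite_monoid_nat_copy[OF this(1-3) assms(1) m(1,2) this(4)]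
  show "\<exists>(N :: nat monoid) \<phi>. monoid N \<and> finite (carrier N) \<and>
      \<phi> \<in> monoid_hom M N \<and> \<phi> m \<noteq> \<phi> m'" .
qed

definition configurations :: "('a, 'c) monoid_scheme \<Rightarrow> 'b set \<Rightarrow> ('a \<Rightarrow> 'b) set" where
  "configurations M A = (carrier M \<rightarrow>\<^sub>E A)"

definition shift :: "('a, 'c) monoid_scheme \<Rightarrow> 'a \<Rightarrow> ('a \<Rightarrow> 'b) \<Rightarrow> ('a \<Rightarrow> 'b)" where
  "shift M m x = (\<lambda>m' \<in> carrier M. x (m' \<otimes>\<^bsub>M\<^esub> m))"

definition agree_entourage ::
    "('a, 'c) monoid_scheme \<Rightarrow> 'b set \<Rightarrow> 'a set \<Rightarrow> (('a \<Rightarrow> 'b) \<times> ('a \<Rightarrow> 'b)) set" where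
  "agree_entourage M A F =
     {(x, y) \<in> configurations M A \<times> configurations M A. restrict x F = restrict y F}"

(* As for the type class uniform_space, a uniform structure is the filter of its entourages;
   the library's class is not applicable because the space is a set, not a type. *)
definition prodiscrete_uniformity ::
    "('a, 'c) monoid_scheme \<Rightarrow> 'b set \<Rightarrow> (('a \<Rightarrow> 'b) \<times> ('a \<Rightarrow> 'b)) filter" where
  "prodiscrete_uniformity M A =
     (INF F \<in> {F. finite F \<and> F \<subseteq> carrier M}. principal (agree_entourage M A F))"

lemma eventually_prodiscrete_uniformity:
  "eventually P (prodiscrete_uniformity M A) \<longleftrightarrow>
     (\<exists>F. finite F \<and> F \<subseteq> carrier M \<and> (\<forall>p \<in> agree_entourage M A F. P p))"
proof -
  have restr: "restrict x F = restrict y F"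
    if "restrict x G = restrict y G" "F \<subseteq> G" for x y :: "'a \<Rightarrow> 'b" and F G
    using that by (metis inf.absorb2 restrict_restrict)
  have "eventually P (prodiscrete_uniformity M A) \<longleftrightarrow>
     (\<exists>F \<in> {F. finite F \<and> F \<subseteq> carrier M}. eventually P (principal (agree_entourage M A F)))"
    unfolding prodiscrete_uniformity_def
  proof (rule eventually_INF_base)
    fix F G assume "F \<in> {F. finite F \<and> F \<subseteq> carrier M}" "G \<in> {F. finite F \<and> F \<subseteq> carrier M}"
    moreover have "agree_entourage M A (F \<union> G) \<subseteq> agree_entourage M A F \<inter> agree_entourage M A G"
      by (auto simp: agree_entourage_def intro: restr)
    ultimately show "\<exists>H\<in>{F. finite F \<and> F \<subseteq> carrier M}.
        principal (agree_entourage M A H)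
          \<le> inf (principal (agree_entourage M A F)) (principal (agree_entourage M A G))"
      by (intro bexI[of _ "F \<union> G"]) auto
  qed auto
  then show ?thesis by (auto simp: eventually_principal)
qed

definition prodiscrete_uniformly_continuous ::
    "('a, 'c) monoid_scheme \<Rightarrow> 'b set \<Rightarrow> (('a \<Rightarrow> 'b) \<Rightarrow> ('a \<Rightarrow> 'b)) \<Rightarrow> bool" where
  "prodiscrete_uniformly_continuous M A \<tau> \<longleftrightarrow>
     (LIM (x, y) prodiscrete_uniformity M A. (\<tau> x, \<tau> y) :> prodiscrete_uniformity M A)"

lemma prodiscrete_uniformly_continuous_iff:
  assumes "\<tau> \<in> configurations M A \<rightarrow> configurations M A"
  shows "prodiscrete_uniformly_continuous M A \<tau> \<longleftrightarrow>
    (\<forall>F. finite F \<and> F \<subseteq> carrier M \<longrightarrow> (\<exists>G. finite G \<and> G \<subseteq> carrier M \<and>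
       (\<forall>x \<in> configurations M A. \<forall>y \<in> configurations M A.
          restrict x G = restrict y G \<longrightarrow> restrict (\<tau> x) F = restrict (\<tau> y) F)))"
  (is "_ \<longleftrightarrow> ?R")
proof -
  have target: "filterlim f (prodiscrete_uniformity M A) G \<longleftrightarrow>
      (\<forall>F. finite F \<and> F \<subseteq> carrier M \<longrightarrow> eventually (\<lambda>p. f p \<in> agree_entourage M A F) G)"
    for f :: "('a \<Rightarrow> 'b) \<times> ('a \<Rightarrow> 'b) \<Rightarrow> ('a \<Rightarrow> 'b) \<times> ('a \<Rightarrow> 'b)" and G
    unfolding prodiscrete_uniformity_def by (simp add: filterlim_INF filterlim_principal)
  have entourage: "(\<forall>p \<in> agree_entourage M A G. (case p of (x, y) \<Rightarrow> (\<tau> x, \<tau> y)) \<in> agree_entourage M A F)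
      \<longleftrightarrow> (\<forall>x \<in> configurations M A. \<forall>y \<in> configurations M A.
          restrict x G = restrict y G \<longrightarrow> restrict (\<tau> x) F = restrict (\<tau> y) F)" for F G
    by (auto simp: agree_entourage_def funcset_mem[OF assms])
  show ?thesis
    unfolding prodiscrete_uniformly_continuous_def target eventually_prodiscrete_uniformity entourage ..
qed

(* Maps on A^M are functions on the ambient type of which only the values on A^M matter. *)
definition cellular_automaton ::
    "('a, 'c) monoid_scheme \<Rightarrow> 'b set \<Rightarrow> (('a \<Rightarrow> 'b) \<Rightarrow> ('a \<Rightarrow> 'b)) \<Rightarrow> bool" where
  "cellular_automaton M A \<tau> \<longleftrightarrow>
     \<tau> \<in> configurations M A \<rightarrow> configurations M A \<and>
     (\<forall>m \<in> carrier M. \<forall>x \<in> configurations M A. \<tau> (shift M m x) = shift M m (\<tau> x)) \<and>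
     prodiscrete_uniformly_continuous M A \<tau>"

(* The type argument is the type from which the alphabets are drawn. *)
definition surjunctive :: "'b itself \<Rightarrow> ('a, 'c) monoid_scheme \<Rightarrow> bool" where
  "surjunctive _ M \<longleftrightarrow>
     (\<forall>(A :: 'b set) \<tau>. finite A \<longrightarrow> cellular_automaton M A \<tau> \<longrightarrow>
        inj_on \<tau> (configurations M A) \<longrightarrow> \<tau> ` configurations M A = configurations M A)"

end

theory Submission
  imports Defs "HOL-Analysis.Function_Topology"
begin

text \<open>
  Let \<open>\<tau>\<close> be an injective cellular automaton and \<open>q\<close> a map with finite range on \<open>M\<close> whose kernel
  is a left congruence. The configurations constant on the fibres of \<open>q\<close> form a finite set which
  \<open>\<tau>\<close> maps into itself, hence, by injectivity, onto itself. Residual finiteness provides, for each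
  finite \<open>F \<subseteq> M\<close>, such a \<open>q\<close> that is injective on \<open>F\<close>, so these configurations are dense and
  \<open>\<tau>\<close> has dense image. As \<open>A\<^sup>M\<close> is compact by Tychonoff's theorem, the image is everything.
\<close>

text \<open>These are the configurations that factor through \<open>q\<close>. Only the kernel of
  \<open>q\<close> enters, so its codomain carries no structure.\<close>

definition fibre_constant ::
    "('a, 'c) monoid_scheme \<Rightarrow> 'b set \<Rightarrow> ('a \<Rightarrow> 'q) \<Rightarrow> ('a \<Rightarrow> 'b) set" where
  "fibre_constant M A q =
     {x \<in> configurations M A. \<forall>m\<in>carrier M. \<forall>m'\<in>carrier M. q m = q m' \<longrightarrow> x m = x m'}"

lemma fibre_constant_subset: "fibre_constant M A q \<subseteq> configurations M A"
  by (auto simp: fibre_constant_def)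

lemma fibre_constantD:
  "\<lbrakk>x \<in> fibre_constant M A q; m \<in> carrier M; m' \<in> carrier M; q m = q m'\<rbrakk> \<Longrightarrow> x m = x m'"
  unfolding fibre_constant_def by blast

text \<open>Such a configuration is determined by the function it induces on the finite range of
  \<open>q\<close>, with values in the finite set \<open>A\<close>.\<close>

lemma finite_fibre_constant:
  assumes "finite A" and fin: "finite (q ` carrier M)"
  shows "finite (fibre_constant M A q)"
proof (rule finite_subset)
  \<comment> \<open>\<open>r\<close> chooses a point in each fibre, so \<open>x \<circ> r\<close> is
    the function induced by \<open>x\<close>.\<close>
  define r where "r = inv_into (carrier M) q"
  have r: "r (q m) \<in> carrier M" "q (r (q m)) = q m" if "m \<in> carrier M" for m
    using that by (auto simp: r_def inv_into_into f_inv_into_f)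
  show "fibre_constant M A q \<subseteq>
      (\<lambda>f. \<lambda>m\<in>carrier M. f (q m)) ` (q ` carrier M \<rightarrow>\<^sub>E A)"
  proof
    fix x assume x: "x \<in> fibre_constant M A q"
    have eq: "x (r (q m)) = x m" if "m \<in> carrier M" for m
      using fibre_constantD[OF x r(1)[OF that] that r(2)[OF that]] .
    have xc: "x \<in> carrier M \<rightarrow>\<^sub>E A"
      using x fibre_constant_subset unfolding configurations_def by blast
    have "restrict (x \<circ> r) (q ` carrier M) \<in> q ` carrier M \<rightarrow>\<^sub>E A"
      using xc r(1) by auto
    moreover have "x = (\<lambda>m\<in>carrier M. restrict (x \<circ> r) (q ` carrier M) (q m))"
      using eq PiE_arb[OF xc] by (auto simp: fun_eq_iff)
    ultimately show "x \<in> (\<lambda>f. \<lambda>m\<in>carrier M. f (q m)) ` (q ` carrier M \<rightarrow>\<^sub>E A)"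
      by (intro image_eqI)
  qed
  show "finite ((\<lambda>f. \<lambda>m\<in>carrier M. f (q m)) ` (q ` carrier M \<rightarrow>\<^sub>E A))"
    by (intro finite_imageI finite_PiE fin \<open>finite A\<close>)
qed

text \<open>Each fibre of \<open>q\<close> meets \<open>F\<close> in at most one point, so the
  values of \<open>y\<close> on \<open>F\<close> spread over the fibres without conflict.\<close>

lemma fibre_constant_interpolation:
  assumes "monoid M" and y: "y \<in> configurations M A" and F: "F \<subseteq> carrier M" "inj_on q F"
  obtains x where "x \<in> fibre_constant M A q" "\<And>m. m \<in> F \<Longrightarrow> x m = y m"
proof
  interpret monoid M by fact
  \<comment> \<open>\<open>r m\<close> depends only on \<open>q m\<close>. On fibres that miss
    \<open>F\<close> the default is the identity, so that \<open>y\<close> still supplies a letter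
    of \<open>A\<close>.\<close>
  define r where "r m = (if q m \<in> q ` F then inv_into F q (q m) else \<one>\<^bsub>M\<^esub>)" for m
  have r: "r m \<in> carrier M" for m
    using F inv_into_into[of "q m" q F] by (auto simp: r_def)
  show "(\<lambda>m\<in>carrier M. y (r m)) \<in> fibre_constant M A q"
    using y r by (auto simp: fibre_constant_def configurations_def r_def)
  show "(\<lambda>m\<in>carrier M. y (r m)) m = y m" if "m \<in> F" for m
    using that F by (auto simp: r_def)
qed

text \<open>Equivariance moves evaluation at \<open>m\<close>, the identity times \<open>m\<close>,
  to the identity.\<close>

lemma cellular_automaton_eq_at_one:
  assumes "monoid M" "cellular_automaton M A \<tau>" "x \<in> configurations M A" "m \<in> carrier M"
  shows "\<tau> x m = \<tau> (shift M m x) \<one>\<^bsub>M\<^esub>"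
proof -
  interpret monoid M by fact
  show ?thesis using assms(2-4) by (simp add: cellular_automaton_def shift_def)
qed

text \<open>If \<open>q m = q m'\<close>, the congruence makes the shifts of \<open>x\<close> by
  \<open>m\<close> and \<open>m'\<close> coincide; the values of \<open>\<tau> x\<close> at
  \<open>m\<close> and \<open>m'\<close> are both read off from this common shift.\<close>

lemma cellular_automaton_fibre_constant:
  assumes M: "monoid M" and ca: "cellular_automaton M A \<tau>"
    and cong: "\<And>k m m'. \<lbrakk>k \<in> carrier M; m \<in> carrier M; m' \<in> carrier M; q m = q m'\<rbrakk>
      \<Longrightarrow> q (k \<otimes>\<^bsub>M\<^esub> m) = q (k \<otimes>\<^bsub>M\<^esub> m')"
    and x: "x \<in> fibre_constant M A q"
  shows "\<tau> x \<in> fibre_constant M A q"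
proof -
  interpret monoid M by fact
  have xc: "x \<in> configurations M A" using x fibre_constant_subset by blast
  have "\<tau> x m = \<tau> x m'" if m: "m \<in> carrier M" "m' \<in> carrier M" "q m = q m'" for m m'
  proof -
    have "shift M m x = shift M m' x"
      unfolding shift_def
    proof (rule restrict_ext)
      fix k assume "k \<in> carrier M"
      with m show "x (k \<otimes>\<^bsub>M\<^esub> m) = x (k \<otimes>\<^bsub>M\<^esub> m')"
        by (intro fibre_constantD[OF x] cong m_closed)
    qed
    then show ?thesis
      by (simp add: cellular_automaton_eq_at_one[OF M ca xc] m)
  qed
  moreover have "\<tau> x \<in> configurations M A"
    using ca xc by (auto simp: cellular_automaton_def)
  ultimately show ?thesis unfolding fibre_constant_def by blast
qed

text \<open>Take one separating morphism for each pair of distinct points of \<open>F\<close> and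
  let \<open>q\<close> be their joint map into the finite product. Its kernel is an intersection of
  kernels of morphisms, hence a congruence.\<close>

lemma residually_finite_separate:
  fixes M :: "('a, 'c) monoid_scheme"
  assumes M: "monoid M" "residually_finite M" and F: "finite F" "F \<subseteq> carrier M"
  obtains q :: "'a \<Rightarrow> 'a \<times> 'a \<Rightarrow> nat"
  where "finite (q ` carrier M)" "inj_on q F"
    and "\<And>k m m'. \<lbrakk>k \<in> carrier M; m \<in> carrier M; m' \<in> carrier M; q m = q m'\<rbrakk>
      \<Longrightarrow> q (k \<otimes>\<^bsub>M\<^esub> m) = q (k \<otimes>\<^bsub>M\<^esub> m')"
proof -
  define P where "P = {p \<in> F \<times> F. fst p \<noteq> snd p}"
  have "\<forall>p\<in>P. \<exists>(N :: nat monoid) \<phi>. finite (carrier N) \<and>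
      \<phi> \<in> monoid_hom M N \<and> \<phi> (fst p) \<noteq> \<phi> (snd p)"
    using M(2) F(2) unfolding residually_finite_def P_def by fastforce
  then obtain N :: "'a \<times> 'a \<Rightarrow> nat monoid" and \<phi>
    where N: "\<And>p. p \<in> P \<Longrightarrow> finite (carrier (N p))"
      and hom: "\<And>p. p \<in> P \<Longrightarrow> \<phi> p \<in> hom M (N p)"
      and ne: "\<And>p. p \<in> P \<Longrightarrow> \<phi> p (fst p) \<noteq> \<phi> p (snd p)"
    unfolding monoid_hom_def by (metis (no_types, lifting) mem_Collect_eq)
  \<comment> \<open>Restricting to \<open>P\<close> puts the range inside a finite
    \<open>PiE\<close> and makes the kernel depend on the coordinates in \<open>P\<close>
    alone.\<close>
  define q where "q m = (\<lambda>p\<in>P. \<phi> p m)" for m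
  have q_eq: "q m = q m' \<longleftrightarrow> (\<forall>p\<in>P. \<phi> p m = \<phi> p m')" for m m'
    by (auto simp: q_def fun_eq_iff)
  have "finite P" using F(1) by (simp add: P_def)
  then have "finite (PiE P (\<lambda>p. carrier (N p)))" by (intro finite_PiE N)
  moreover have "q ` carrier M \<subseteq> PiE P (\<lambda>p. carrier (N p))"
    using hom by (auto simp: q_def hom_def Pi_iff)
  ultimately have "finite (q ` carrier M)" by (rule rev_finite_subset)
  moreover have "inj_on q F"
  proof (rule inj_onI, rule ccontr)
    fix m m' assume "m \<in> F" "m' \<in> F" "q m = q m'" "m \<noteq> m'"
    then show False using ne[of "(m, m')"] by (auto simp: q_eq P_def)
  qed
  moreover have "q (k \<otimes>\<^bsub>M\<^esub> m) = q (k \<otimes>\<^bsub>M\<^esub> m')"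
    if "k \<in> carrier M" "m \<in> carrier M" "m' \<in> carrier M" "q m = q m'" for k m m'
    using that by (simp add: q_eq hom_mult[OF hom])
  ultimately show thesis by (rule that)
qed

text \<open>This is density of the image: by finiteness, a fibre-constant configuration agreeing
  with \<open>y\<close> on \<open>F\<close> has a preimage.\<close>

lemma injective_cellular_automaton_dense_image:
  fixes M :: "('a, 'c) monoid_scheme"
  assumes M: "monoid M" "residually_finite M" and A: "finite A"
    and ca: "cellular_automaton M A \<tau>" and inj: "inj_on \<tau> (configurations M A)"
    and y: "y \<in> configurations M A" and F: "finite F" "F \<subseteq> carrier M"
  obtains x where "x \<in> configurations M A" "\<And>m. m \<in> F \<Longrightarrow> \<tau> x m = y m"
proof -
  obtain q :: "'a \<Rightarrow> 'a \<times> 'a \<Rightarrow> nat" where q: "finite (q ` carrier M)" "inj_on q F"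
    and cong: "\<And>k m m'. \<lbrakk>k \<in> carrier M; m \<in> carrier M; m' \<in> carrier M; q m = q m'\<rbrakk>
      \<Longrightarrow> q (k \<otimes>\<^bsub>M\<^esub> m) = q (k \<otimes>\<^bsub>M\<^esub> m')"
    using residually_finite_separate[OF M F] by blast
  let ?X = "fibre_constant M A q"
  \<comment> \<open>\<open>z\<close> approximates \<open>y\<close> among the values of
    \<open>\<tau>\<close>; the configuration sought is a preimage of \<open>z\<close>.\<close>
  obtain z where z: "z \<in> ?X" "\<And>m. m \<in> F \<Longrightarrow> z m = y m"
    using fibre_constant_interpolation[OF M(1) y F(2) q(2)] by blast
  have "\<tau> ` ?X = ?X"
  proof (rule endo_inj_surj)
    show "finite ?X" by (rule finite_fibre_constant[OF A q(1)])
    show "\<tau> ` ?X \<subseteq> ?X" using cellular_automaton_fibre_constant[OF M(1) ca, of q] cong by blast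
    show "inj_on \<tau> ?X" by (rule inj_on_subset[OF inj fibre_constant_subset])
  qed
  with z(1) have "z \<in> \<tau> ` ?X" by (simp only:)
  then obtain x where x: "x \<in> ?X" "z = \<tau> x" by (rule imageE)
  show thesis
  proof (rule that)
    show "x \<in> configurations M A" using x(1) fibre_constant_subset by (rule rev_subsetD)
    show "\<tau> x m = y m" if "m \<in> F" for m
      using z(2)[OF that] by (simp only: x(2))
  qed
qed

text \<open>Around each of its points, \<open>S\<close> contains the cylinder fixing the coordinates
  in \<open>G\<close>. This links the finite agreement sets of the prodiscrete structure to the
  product topology.\<close>

lemma openin_product_discrete:
  assumes G: "finite G" "G \<subseteq> I" and S: "S \<subseteq> I \<rightarrow>\<^sub>E A"
    and dep: "\<And>x y. \<lbrakk>x \<in> S; y \<in> I \<rightarrow>\<^sub>E A; \<And>i. i \<in> G \<Longrightarrow> x i = y i\<rbrakk> \<Longrightarrow> y \<in> S"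
  shows "openin (product_topology (\<lambda>_. discrete_topology A) I) S"
  unfolding openin_product_topology_alt
proof
  fix x assume x: "x \<in> S"
  \<comment> \<open>Only the factors at coordinates in \<open>G\<close> can differ from
    \<open>A\<close>.\<close>
  define U where "U i = (if i \<in> G then {x i} else A)" for i
  have "finite {i \<in> I. U i \<noteq> topspace (discrete_topology A)}"
    by (rule finite_subset[OF _ G(1)]) (auto simp: U_def)
  moreover have "\<forall>i\<in>I. openin (discrete_topology A) (U i)" "x \<in> PiE I U"
    using x S by (auto simp: U_def PiE_iff dest: subsetD)
  moreover have "PiE I U \<subseteq> S"
  proof
    fix y assume y: "y \<in> PiE I U"
    have "U i \<subseteq> A" if "i \<in> I" for i
      using x S that by (auto simp: U_def PiE_iff dest: subsetD)
    with y have "y \<in> I \<rightarrow>\<^sub>E A" by (meson PiE_mono subsetD)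
    moreover have "x i = y i" if "i \<in> G" for i
      using PiE_mem[OF y, of i] that G(2) by (auto simp: U_def)
    ultimately show "y \<in> S" by (rule dep[OF x])
  qed
  ultimately show "\<exists>U. finite {i \<in> I. U i \<noteq> topspace (discrete_topology A)} \<and>
      (\<forall>i\<in>I. openin (discrete_topology A) (U i)) \<and> x \<in> PiE I U \<and> PiE I U \<subseteq> S"
    by blast
qed

text \<open>Uniform continuity, applied to the finite set \<open>{m}\<close>, makes
  \<open>\<tau> x m\<close> depend on finitely many coordinates of \<open>x\<close>, so the
  complement is open.\<close>

lemma closedin_cellular_automaton_value:
  assumes ca: "cellular_automaton M A \<tau>" and m: "m \<in> carrier M"
  shows "closedin (product_topology (\<lambda>_. discrete_topology A) (carrier M))
    {x \<in> configurations M A. \<tau> x m = a}"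
proof -
  have "\<tau> \<in> configurations M A \<rightarrow> configurations M A"
    and "prodiscrete_uniformly_continuous M A \<tau>"
    using ca by (auto simp: cellular_automaton_def)
  from this(2)[unfolded prodiscrete_uniformly_continuous_iff[OF this(1)], rule_format, of "{m}"] m
  obtain G where G: "finite G" "G \<subseteq> carrier M"
    and dep: "\<And>x y. \<lbrakk>x \<in> configurations M A; y \<in> configurations M A;
        restrict x G = restrict y G\<rbrakk> \<Longrightarrow> restrict (\<tau> x) {m} = restrict (\<tau> y) {m}"
    by auto
  have dep': "\<tau> x m = \<tau> y m"
    if "x \<in> configurations M A" "y \<in> configurations M A" "\<And>i. i \<in> G \<Longrightarrow> x i = y i" for x y
    using fun_cong[OF dep[OF that(1,2) restrict_ext], of m] that(3) by simp
  have "openin (product_topology (\<lambda>_. discrete_topology A) (carrier M))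
      {x \<in> configurations M A. \<tau> x m \<noteq> a}"
  proof (rule openin_product_discrete[OF G])
    fix x y assume "x \<in> {x \<in> configurations M A. \<tau> x m \<noteq> a}" "y \<in> carrier M \<rightarrow>\<^sub>E A"
      "\<And>i. i \<in> G \<Longrightarrow> x i = y i"
    then show "y \<in> {x \<in> configurations M A. \<tau> x m \<noteq> a}"
      using dep'[of x y] by (auto simp: configurations_def)
  qed (auto simp: configurations_def)
  moreover have "(carrier M \<rightarrow>\<^sub>E A) - {x \<in> configurations M A. \<tau> x m = a} =
      {x \<in> configurations M A. \<tau> x m \<noteq> a}"
    by (auto simp: configurations_def)
  ultimately show ?thesis
    by (auto simp: closedin_def configurations_def)
qed

theorem theorem5p17:
  fixes M :: "('a, 'c) monoid_scheme"
  assumes "monoid M"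
    and "residually_finite M"
  shows "surjunctive TYPE('b) M"
  unfolding surjunctive_def
proof (intro allI impI equalityI subsetI)
  fix A :: "'b set" and \<tau> y
  assume A: "finite A" and ca: "cellular_automaton M A \<tau>"
    and inj: "inj_on \<tau> (configurations M A)"
  have \<tau>: "\<tau> x \<in> configurations M A" if "x \<in> configurations M A" for x
    using ca that by (auto simp: cellular_automaton_def)
  show "y \<in> configurations M A" if "y \<in> \<tau> ` configurations M A"
    using \<tau> that by blast
  assume y: "y \<in> configurations M A"
  let ?T = "product_topology (\<lambda>_. discrete_topology A) (carrier M)"
  \<comment> \<open>A point common to all \<open>C m\<close> is a preimage of \<open>y\<close>; each
    position contributes one closed condition.\<close>
  define C where "C m = {x \<in> configurations M A. \<tau> x m = y m}" for m
  interpret monoid M by fact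
  have "compact_space ?T"
    using A by (simp add: compact_space_product_topology compact_space_discrete_topology)
  moreover have "closedin ?T D" if "D \<in> C ` carrier M" for D
    using that closedin_cellular_automaton_value[OF ca] by (auto simp: C_def)
  \<comment> \<open>A finite subfamily comes from a finite set of positions, so the finite
    intersection property follows from density.\<close>
  moreover have "\<Inter>\<D> \<noteq> {}" if D: "finite \<D>" "\<D> \<subseteq> C ` carrier M" for \<D>
  proof -
    obtain F where F: "F \<subseteq> carrier M" "finite F" "\<D> = C ` F"
      using finite_subset_image[OF D] by blast
    obtain x where "x \<in> configurations M A" "\<And>m. m \<in> F \<Longrightarrow> \<tau> x m = y m"
      using injective_cellular_automaton_dense_image[OF assms A ca inj y F(2,1)] by blast
    then have "x \<in> \<Inter>\<D>" by (auto simp: F(3) C_def)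
    then show ?thesis by blast
  qed
  ultimately have "\<Inter>(C ` carrier M) \<noteq> {}"
    unfolding compact_space_fip by blast
  then obtain x where x: "\<And>m. m \<in> carrier M \<Longrightarrow> x \<in> C m" by blast
  \<comment> \<open>The identity makes the family nonempty, so the common point lies in some
    \<open>C m\<close> and is a configuration.\<close>
  have xc: "x \<in> configurations M A" using x[OF one_closed] by (simp add: C_def)
  have "\<tau> x = y"
  proof (rule PiE_ext)
    show "\<tau> x \<in> carrier M \<rightarrow>\<^sub>E A" "y \<in> carrier M \<rightarrow>\<^sub>E A"
      using \<tau>[OF xc] y by (simp_all add: configurations_def)
    show "\<tau> x m = y m" if "m \<in> carrier M" for m
      using x[OF that] by (simp add: C_def)
  qed
  with xc show "y \<in> \<tau> ` configurations M A" by blast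
qed

end
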